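(* Let $X$ be a Hilbert space with scalar product $\langle\cdot,\cdot\rangle$, $U$ a normed linear space, and let $A$ be the generator of an analytic semigroup on $X$. Let $f$ be an $X$-valued function defined on an open set $Q\subset X\times U$ with $(0,0)\in Q$ and $f(0,0)=0$, and suppose that $f(x,u)=Bx+Cu+g(x,u)$ with $B\in L(X)$, $C\in L(U,X)$, where for each $w>0$ there exists $\rho>0$ such that for all $x$ with $\|x\|_X\le\rho$ and all $u$ with $\|u\|_U\le\rho$ $$\|g(x,u)\|_X\le w(\|x\|_X+\|u\|_U).$$ Consider the nonlinear control system $$\dot x(t)=Ax(t)+f(x(t),u(t)),\qquad x(t)\in X,\ u(t)\in U,$$ and its linear approximation $\dot x=Rx+Cu$, $R=A+B$. Suppose that the linear system $\dot x=Rx+Cu$ is input-to-state stable (ISS) and that there exists a coercive operator $P\in L(X)$ satisfying $$\langle Rx,Px\rangle+\langle Px,Rx\rangle=-\|x\|_X^2\qquad\forall x\in D(R).$$ Then $$V(x)=\langle Px,x\rangle$$ is a local ISS-Lyapunov function for the nonlinear system.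
   Context: $L(U,X)$ is the space of bounded linear operators $U\to X$, $L(X)=L(X,X)$. $R=A+B$, $D(R)=D(A)$, generates an analytic semigroup. A self-adjoint operator $P\in L(X)$ is positive if $\langle Px,x\rangle>0$ for all $x\ne0$; a positive operator $P$ is coercive if there is $\epsilon>0$ with $\langle Px,x\rangle\ge\epsilon\|x\|_X^2$ for all $x$. Inputs: $U_c$ is a linear space of bounded strongly measurable functions $u:\mathbb{R}_+\to U$ (e.g. piecewise right-continuous or continuous functions), with norm $\|u\|_{U_c}=\sup_{s\ge0}\|u(s)\|_U$. Solutions are mild solutions: with $S$ the semigroup generated by $A$, $x(t)=S(t)x_0+\int_0^tS(t-s)f(x(s),u(s))\,ds$ for the nonlinear system, and with $T$ the semigroup generated by $R$, $x(t)=T(t)x_0+\int_0^tT(t-s)Cu(s)\,ds$ for the linear one (Bochner integrals). Write $\phi(t,x_0,u)$ for the solution with initial state $x_0$ at time $0$ and input $u\in U_c$. It is a standing assumption that these equations define time-invariant control systems $(X,U_c,\phi)$: a solution exists (locally in time) and is unique, is continuous in $t$, depends on $u$ only through its values up to the current time, has the semigroup (cocycle) property, and the BIC property holds: there is a maximal existence time $t_m\in(0,\infty]$, and if $t_m<\infty$ then $\|\phi(t,x_0,u)\|_X$ is unbounded on $[0,t_m)$. $\mathcal K$: continuous strictly increasing $\gamma:\mathbb{R}_+\to\mathbb{R}_+$ with $\gamma(0)=0$; $\mathcal K_\infty$: unbounded elements of $\mathcal K$. $\mathcal{KL}$: functions $\beta:\mathbb{R}_+^2\to\mathbb{R}_+$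 with $\beta(\cdot,t)\in\mathcal K$ for each $t\ge0$ and $\beta(r,\cdot)$ continuous, decreasing, tending to $0$ at infinity for each $r>0$. A positive definite function is a continuous $\alpha:\mathbb{R}_+\to\mathbb{R}_+$ with $\alpha(0)=0$, $\alpha(r)>0$ for $r>0$. ISS: there exist $\beta\in\mathcal{KL}$, $\gamma\in\mathcal K$ such that $\|\phi(t,x_0,u)\|_X\le\beta(\|x_0\|_X,t)+\gamma(\|u\|_{U_c})$ for all $x_0\in X$, $u\in U_c$, $t\ge0$. Local ISS-Lyapunov function: a continuous function $V:D\to\mathbb{R}_+$, $D\subset X$, $0\in\mathrm{int}(D)$, for which there exist $\rho_x,\rho_u>0$ (with $\{\|x\|_X\le\rho_x\}\subset\mathrm{int}(D)$), $\psi_1,\psi_2\in\mathcal K_\infty$, $\chi\in\mathcal K$ and a positive definite function $\alpha$ such that $\psi_1(\|x\|_X)\le V(x)\le\psi_2(\|x\|_X)$ for all $x\in D$, and for all $x$ with $\|x\|_X\le\rho_x$ and all $u\in U_c$ with $\|u\|_{U_c}\le\rho_u$: $\|x\|_X\ge\chi(\|u\|_{U_c})$ implies $\dot V_u(x)\le-\alpha(\|x\|_X)$, where $\dot V_u(x)=\limsup_{t\to+0}\frac1t\big(V(\phi(t,x,u))-V(x)\big)$. *)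

theory Defs
  imports "HOL-Analysis.Analysis"
begin

text \<open>
  A Hilbert space is a type of sort \<open>{real_inner, complete_space}\<close>.  Complex Hilbert spaces are
  covered through their underlying real structure, with scalar product \<open>Re \<langle>x, y\<rangle>\<close>: every notion
  below is invariant under this restriction of scalars.
\<close>

subsection \<open>Strong measurability and the Bochner integral\<close>

text \<open>
  The Bochner integral of the library is restricted to second countable spaces, so it would force
  the state space to be separable.  The following is its usual definition without this restriction;
  it is only applied to complete measures.
\<close>

definition strongly_measurable :: "'a measure \<Rightarrow> ('a \<Rightarrow> 'b::real_normed_vector) \<Rightarrow> bool" where
  "strongly_measurable M f \<longleftrightarrow>
     (\<exists>s. (\<forall>i. simple_function M (s i)) \<and> (AE x in M. (\<lambda>i::nat. s i x) \<longlonglongrightarrow> f x))"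

definition has_strong_bochner_integral ::
    "'a measure \<Rightarrow> ('a \<Rightarrow> 'b::real_normed_vector) \<Rightarrow> 'b \<Rightarrow> bool" where
  "has_strong_bochner_integral M f I \<longleftrightarrow>
     strongly_measurable M f \<and>
     (\<exists>s. (\<forall>i::nat. Bochner_Integration.simple_bochner_integrable M (s i)) \<and>
          (\<lambda>i. \<integral>\<^sup>+x. ennreal (norm (f x - s i x)) \<partial>M) \<longlonglongrightarrow> 0 \<and>
          (\<lambda>i. Bochner_Integration.simple_bochner_integral M (s i)) \<longlonglongrightarrow> I)"

subsection \<open>Semigroups of operators\<close>

definition C0_semigroup :: "(real \<Rightarrow> 'x::real_normed_vector \<Rightarrow> 'x) \<Rightarrow> bool" where
  "C0_semigroup S \<longleftrightarrow>
     (\<forall>t\<ge>0. bounded_linear (S t)) \<and>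
     (\<forall>x. S 0 x = x) \<and>
     (\<forall>s\<ge>0. \<forall>t\<ge>0. \<forall>x. S (s + t) x = S s (S t x)) \<and>
     (\<forall>x. ((\<lambda>t. S t x) \<longlongrightarrow> x) (at_right 0))"

text \<open>\<open>A\<close> with domain \<open>DA\<close> is the infinitesimal generator of \<open>S\<close>; values of \<open>A\<close> outside \<open>DA\<close> are
  irrelevant.\<close>

definition generator_of ::
    "('x::real_normed_vector \<Rightarrow> 'x) \<Rightarrow> 'x set \<Rightarrow> (real \<Rightarrow> 'x \<Rightarrow> 'x) \<Rightarrow> bool" where
  "generator_of A DA S \<longleftrightarrow>
     DA = {x. \<exists>y. ((\<lambda>t. (S t x - x) /\<^sub>R t) \<longlongrightarrow> y) (at_right 0)} \<and>
     (\<forall>x\<in>DA. ((\<lambda>t. (S t x - x) /\<^sub>R t) \<longlongrightarrow> A x) (at_right 0))"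

text \<open>Multiplication by a complex scalar in the complexification of \<open>'x\<close>, where \<open>(a, b)\<close> stands
  for \<open>a + \<i> b\<close>.\<close>

definition cscale :: "complex \<Rightarrow> 'x::real_vector \<times> 'x \<Rightarrow> 'x \<times> 'x" where
  "cscale c p = (Re c *\<^sub>R fst p - Im c *\<^sub>R snd p, Re c *\<^sub>R snd p + Im c *\<^sub>R fst p)"

definition sector :: "real \<Rightarrow> complex set" where
  "sector \<theta> = {z. z \<noteq> 0 \<and> \<bar>Arg z\<bar> < \<theta>}"

text \<open>A \<open>C\<^sub>0\<close>-semigroup is analytic if its complexification extends to a holomorphic semigroup \<open>Z\<close>
  of complex-linear bounded operators, strongly continuous at \<open>0\<close>, on an open sector around the
  positive real axis.\<close>

definition analytic_semigroup :: "(real \<Rightarrow> 'x::real_normed_vector \<Rightarrow> 'x) \<Rightarrow> bool" where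
  "analytic_semigroup S \<longleftrightarrow> C0_semigroup S \<and>
     (\<exists>\<theta> Z. 0 < \<theta> \<and> \<theta> \<le> pi / 2 \<and>
        (\<forall>z\<in>sector \<theta>. bounded_linear (Z z) \<and> (\<forall>c p. Z z (cscale c p) = cscale c (Z z p))) \<and>
        (\<forall>t>0. \<forall>x y. Z (complex_of_real t) (x, y) = (S t x, S t y)) \<and>
        (\<forall>z\<in>sector \<theta>. \<forall>w\<in>sector \<theta>. \<forall>p. Z (z + w) p = Z z (Z w p)) \<and>
        (\<forall>p. \<forall>z\<in>sector \<theta>. \<exists>d. ((\<lambda>\<zeta>. Z \<zeta> p) has_derivative (\<lambda>h. cscale h d)) (at z)) \<and>
        (\<forall>p. ((\<lambda>z. Z z p) \<longlongrightarrow> p) (at 0 within sector \<theta>)))"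

definition positive_operator :: "('x::real_inner \<Rightarrow> 'x) \<Rightarrow> bool" where
  "positive_operator P \<longleftrightarrow>
     bounded_linear P \<and> (\<forall>x y. inner (P x) y = inner x (P y)) \<and> (\<forall>x. x \<noteq> 0 \<longrightarrow> inner (P x) x > 0)"

definition coercive_operator :: "('x::real_inner \<Rightarrow> 'x) \<Rightarrow> bool" where
  "coercive_operator P \<longleftrightarrow>
     positive_operator P \<and> (\<exists>\<epsilon>>0. \<forall>x. inner (P x) x \<ge> \<epsilon> * (norm x)\<^sup>2)"

subsection \<open>Inputs\<close>

text \<open>Inputs are functions on \<open>[0, \<infinity>)\<close>, represented by functions on the reals whose values at
  negative arguments play no role.\<close>

definition input_space :: "(real \<Rightarrow> 'u::real_normed_vector) set \<Rightarrow> bool" where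
  "input_space Uc \<longleftrightarrow>
     (\<lambda>_. 0) \<in> Uc \<and>
     (\<forall>u\<in>Uc. \<forall>v\<in>Uc. (\<lambda>s. u s + v s) \<in> Uc) \<and>
     (\<forall>c. \<forall>u\<in>Uc. (\<lambda>s. c *\<^sub>R u s) \<in> Uc) \<and>
     (\<forall>u\<in>Uc. bounded (u ` {0..}) \<and> strongly_measurable (lebesgue_on {0..}) u)"

definition input_norm :: "(real \<Rightarrow> 'u::real_normed_vector) \<Rightarrow> real" where
  "input_norm u = (SUP s\<in>{0..}. norm (u s))"

subsection \<open>Mild solutions and control systems\<close>

text \<open>\<open>y\<close> is a mild solution on \<open>[0, \<tau>)\<close> of \<open>x' = A x + f(x, u)\<close>, \<open>x(0) = x0\<close>, where \<open>A\<close>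
  generates \<open>S\<close> and \<open>f\<close> is defined on \<open>Q\<close>.\<close>

definition mild_solution ::
    "(real \<Rightarrow> 'x \<Rightarrow> 'x) \<Rightarrow> ('x \<times> 'u) set \<Rightarrow> ('x \<Rightarrow> 'u \<Rightarrow> 'x::real_normed_vector) \<Rightarrow>
     'x \<Rightarrow> (real \<Rightarrow> 'u) \<Rightarrow> ereal \<Rightarrow> (real \<Rightarrow> 'x) \<Rightarrow> bool" where
  "mild_solution S Q f x0 u \<tau> y \<longleftrightarrow>
     continuous_on {t. 0 \<le> t \<and> ereal t < \<tau>} y \<and>
     (\<forall>t. 0 \<le> t \<and> ereal t < \<tau> \<longrightarrow>
        (y t, u t) \<in> Q \<and>
        has_strong_bochner_integral (lebesgue_on {0..t}) (\<lambda>s. S (t - s) (f (y s) (u s)))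
          (y t - S t x0))"

text \<open>Points of \<open>Z\<close> have a uniform distance to the complement of \<open>Q\<close>; this always holds for
  \<open>Q = UNIV\<close>.\<close>

definition well_inside :: "'a::metric_space set \<Rightarrow> 'a set \<Rightarrow> bool" where
  "well_inside Q Z \<longleftrightarrow> (\<exists>\<epsilon>>0. \<forall>z\<in>Z. ball z \<epsilon> \<subseteq> Q)"

text \<open>
  \<open>\<phi> t x u\<close> is the maximal mild solution, with maximal existence time \<open>tm x u\<close>.  The clauses are:
  existence and uniqueness, local existence, causality, the cocycle property (\<open>v\<close> is the input \<open>u\<close>
  shifted by \<open>r\<close>), and the BIC property.  For \<open>Q = UNIV\<close> the two conditions on \<open>well_inside\<close> hold
  trivially: a local solution exists for all \<open>x\<close> and \<open>u\<close>, and the trajectory is unbounded whenever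
  \<open>tm x u < \<infinity>\<close>.  For a proper subset \<open>Q\<close> no local solution is required for data outside of \<open>Q\<close>
  (there \<open>tm x u = 0\<close> is possible), and a solution may also end by reaching the boundary of \<open>Q\<close>.
\<close>

definition control_system ::
    "(real \<Rightarrow> 'x \<Rightarrow> 'x) \<Rightarrow> ('x \<times> 'u) set \<Rightarrow> ('x \<Rightarrow> 'u \<Rightarrow> 'x) \<Rightarrow> (real \<Rightarrow> 'u) set \<Rightarrow>
     ('x::real_normed_vector \<Rightarrow> (real \<Rightarrow> 'u::real_normed_vector) \<Rightarrow> ereal) \<Rightarrow>
     (real \<Rightarrow> 'x \<Rightarrow> (real \<Rightarrow> 'u) \<Rightarrow> 'x) \<Rightarrow> bool" where
  "control_system S Q f Uc tm \<phi> \<longleftrightarrow>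
     (\<forall>x. \<forall>u\<in>Uc. mild_solution S Q f x u (tm x u) (\<lambda>t. \<phi> t x u)) \<and>
     (\<forall>x. \<forall>u\<in>Uc. \<forall>\<tau> y. mild_solution S Q f x u \<tau> y \<longrightarrow>
        \<tau> \<le> tm x u \<and> (\<forall>t. 0 \<le> t \<and> ereal t < \<tau> \<longrightarrow> y t = \<phi> t x u)) \<and>
     (\<forall>x. \<forall>u\<in>Uc. (\<exists>\<delta>>0. well_inside Q ({x} \<times> u ` {0..<\<delta>})) \<longrightarrow> 0 < tm x u) \<and>
     (\<forall>x. \<forall>u\<in>Uc. \<forall>v\<in>Uc. \<forall>t\<ge>0.
        (\<forall>s\<in>{0..t}. u s = v s) \<and> ereal t < tm x u \<and> ereal t < tm x v \<longrightarrow> \<phi> t x u = \<phi> t x v) \<and>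
     (\<forall>x. \<forall>u\<in>Uc. \<forall>v\<in>Uc. \<forall>r\<ge>0. \<forall>h\<ge>0.
        (\<forall>s\<ge>0. v s = u (r + s)) \<and> ereal (r + h) < tm x u \<longrightarrow>
        ereal h < tm (\<phi> r x u) v \<and> \<phi> h (\<phi> r x u) v = \<phi> (r + h) x u) \<and>
     (\<forall>x. \<forall>u\<in>Uc. \<forall>T>0. tm x u = ereal T \<longrightarrow>
        \<not> bounded ((\<lambda>t. \<phi> t x u) ` {0..<T}) \<or>
        \<not> (\<exists>\<delta>>0. \<delta> \<le> T \<and>
              well_inside Q ((\<lambda>t. \<phi> t x u) ` {T - \<delta>..<T} \<times> u ` {T - \<delta>..<T + \<delta>})))"

subsection \<open>Comparison functions and stability\<close>

definition class_K :: "(real \<Rightarrow> real) \<Rightarrow> bool" where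
  "class_K \<gamma> \<longleftrightarrow> continuous_on {0..} \<gamma> \<and> strict_mono_on {0..} \<gamma> \<and> \<gamma> 0 = 0"

definition class_K_inf :: "(real \<Rightarrow> real) \<Rightarrow> bool" where
  "class_K_inf \<gamma> \<longleftrightarrow> class_K \<gamma> \<and> \<not> bdd_above (\<gamma> ` {0..})"

definition class_KL :: "(real \<Rightarrow> real \<Rightarrow> real) \<Rightarrow> bool" where
  "class_KL \<beta> \<longleftrightarrow>
     (\<forall>t\<ge>0. class_K (\<lambda>r. \<beta> r t)) \<and>
     (\<forall>r>0. continuous_on {0..} (\<beta> r) \<and> antimono_on {0..} (\<beta> r) \<and> (\<beta> r \<longlongrightarrow> 0) at_top)"

definition positive_definite_fun :: "(real \<Rightarrow> real) \<Rightarrow> bool" where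
  "positive_definite_fun \<alpha> \<longleftrightarrow> continuous_on {0..} \<alpha> \<and> \<alpha> 0 = 0 \<and> (\<forall>r>0. \<alpha> r > 0)"

definition input_to_state_stable ::
    "(real \<Rightarrow> 'u::real_normed_vector) set \<Rightarrow> ('x::real_normed_vector \<Rightarrow> (real \<Rightarrow> 'u) \<Rightarrow> ereal) \<Rightarrow>
     (real \<Rightarrow> 'x \<Rightarrow> (real \<Rightarrow> 'u) \<Rightarrow> 'x) \<Rightarrow> bool" where
  "input_to_state_stable Uc tm \<phi> \<longleftrightarrow>
     (\<forall>x. \<forall>u\<in>Uc. tm x u = \<infinity>) \<and>
     (\<exists>\<beta> \<gamma>. class_KL \<beta> \<and> class_K \<gamma> \<and>
        (\<forall>x. \<forall>u\<in>Uc. \<forall>t\<ge>0. norm (\<phi> t x u) \<le> \<beta> (norm x) t + \<gamma> (input_norm u)))"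

definition Lie_derivative ::
    "(real \<Rightarrow> 'x \<Rightarrow> (real \<Rightarrow> 'u) \<Rightarrow> 'x) \<Rightarrow> ('x \<Rightarrow> real) \<Rightarrow> (real \<Rightarrow> 'u) \<Rightarrow> 'x \<Rightarrow> ereal" where
  "Lie_derivative \<phi> V u x = Limsup (at_right 0) (\<lambda>t. ereal ((V (\<phi> t x u) - V x) / t))"

text \<open>The clause \<open>0 < tm x u\<close> states that the local solution entering the Lie derivative exists.\<close>

definition local_ISS_Lyapunov_function ::
    "(real \<Rightarrow> 'u::real_normed_vector) set \<Rightarrow> ('x::real_normed_vector \<Rightarrow> (real \<Rightarrow> 'u) \<Rightarrow> ereal) \<Rightarrow>
     (real \<Rightarrow> 'x \<Rightarrow> (real \<Rightarrow> 'u) \<Rightarrow> 'x) \<Rightarrow> 'x set \<Rightarrow> ('x \<Rightarrow> real) \<Rightarrow> bool" where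
  "local_ISS_Lyapunov_function Uc tm \<phi> D V \<longleftrightarrow>
     0 \<in> interior D \<and> continuous_on D V \<and> (\<forall>x\<in>D. 0 \<le> V x) \<and>
     (\<exists>\<rho>x>0. \<exists>\<rho>u>0. \<exists>\<psi>1 \<psi>2 \<eta> \<alpha>.
        cball 0 \<rho>x \<subseteq> interior D \<and>
        class_K_inf \<psi>1 \<and> class_K_inf \<psi>2 \<and> class_K \<eta> \<and> positive_definite_fun \<alpha> \<and>
        (\<forall>x\<in>D. \<psi>1 (norm x) \<le> V x \<and> V x \<le> \<psi>2 (norm x)) \<and>
        (\<forall>x. \<forall>u\<in>Uc. norm x \<le> \<rho>x \<and> input_norm u \<le> \<rho>u \<and> norm x \<ge> \<eta> (input_norm u) \<longrightarrow>
           0 < tm x u \<and> Lie_derivative \<phi> V u x \<le> ereal (- \<alpha> (norm x))))"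

end

(*
  Along the semigroup S of A the quadratic form V x = <P x, x> can be differentiated at every t > 0,
  because analyticity puts S t x into the domain of A; by the Lyapunov equation for R = A + B the
  derivative is q (S t x) with q x = - |x|^2 - 2 <B x, P x>.  Letting t tend to 0, the slope of
  V (S t x) at 0 is q x for every x, also outside of the domain, and coercivity of P turns
  q <= \<omega> V into local boundedness of S.  The mild solution of the nonlinear equation is
  S t x + t B x up to an error t (K sup |f - B x| + o(1)).  Hence the Lie derivative of V is at most
  - |x|^2 plus a multiple of |x| (|u| + w (|x| + |u|)), where w can be made small near 0.
*)

theory Submission
  imports Defs
begin

section \<open>Measurability and estimates for the strong Bochner integral\<close>

text \<open>Completeness of Lebesgue measure makes changes on a null set harmless. Extension by zero
  outside \<open>D\<close> reduces the claim to the whole line.\<close>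

lemma borel_measurable_lebesgue_on_AE_limit:
  fixes f :: "real \<Rightarrow> real"
  assumes D: "D \<in> sets lebesgue"
    and s: "\<And>i. s i \<in> borel_measurable (lebesgue_on D)"
    and lim: "AE x in lebesgue_on D. (\<lambda>i::nat. s i x) \<longlonglongrightarrow> f x"
  shows "f \<in> borel_measurable (lebesgue_on D)"
proof -
  let ?s = "\<lambda>i x. if x \<in> D then s i x else 0"
  have "(\<lambda>x. lim (\<lambda>i. ?s i x)) \<in> borel_measurable lebesgue"
    using s D by (intro borel_measurable_lim_metric) (simp add: borel_measurable_if)
  moreover have "AE x in lebesgue. lim (\<lambda>i. ?s i x) = (if x \<in> D then f x else 0)"
    using lim D by (subst (asm) AE_restrict_space_iff) (auto simp: limI elim!: eventually_mono)
  ultimately have "(\<lambda>x. if x \<in> D then f x else 0) \<in> borel_measurable lebesgue"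
    by (rule borel_measurable_AE)
  then show ?thesis
    using D by (simp add: borel_measurable_if)
qed

text \<open>Pairing with a fixed vector reduces the strong integral to a real-valued one, to which
  monotonicity applies. The simple functions approximating \<open>F\<close>, paired with
  \<open>v\<close>, have an L1 error at most \<open>norm v\<close> times the original one.\<close>

lemma has_strong_bochner_integral_inner:
  fixes F :: "real \<Rightarrow> 'x::real_inner"
  assumes D: "D \<in> sets lebesgue" and F: "has_strong_bochner_integral (lebesgue_on D) F I"
  shows "has_bochner_integral (lebesgue_on D) (\<lambda>s. inner (F s) v) (inner I v)"
proof -
  let ?M = "lebesgue_on D"
  from F obtain r where r: "\<And>i. simple_function ?M (r i)"
    and rlim: "AE x in ?M. (\<lambda>i::nat. r i x) \<longlonglongrightarrow> F x"
    unfolding has_strong_bochner_integral_def strongly_measurable_def by blast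
  from F obtain s where s: "\<And>i. Bochner_Integration.simple_bochner_integrable ?M (s i)"
    and slim: "(\<lambda>i::nat. \<integral>\<^sup>+x. ennreal (norm (F x - s i x)) \<partial>?M) \<longlonglongrightarrow> 0"
    and sint: "(\<lambda>i. Bochner_Integration.simple_bochner_integral ?M (s i)) \<longlonglongrightarrow> I"
    unfolding has_strong_bochner_integral_def by blast
  show ?thesis
  proof (rule has_bochner_integral.intros)
    show "(\<lambda>x. inner (F x) v) \<in> borel_measurable ?M"
    proof (rule borel_measurable_lebesgue_on_AE_limit[OF D])
      show "(\<lambda>x. inner (r i x) v) \<in> borel_measurable ?M" for i
        by (intro borel_measurable_simple_function simple_function_compose1[OF r])
      show "AE x in ?M. (\<lambda>i. inner (r i x) v) \<longlonglongrightarrow> inner (F x) v"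
        using rlim by (rule eventually_mono) (intro tendsto_intros)
    qed
    show "Bochner_Integration.simple_bochner_integrable ?M (\<lambda>x. inner (s i x) v)" for i
      by (rule simple_bochner_integrable_compose2[where p="\<lambda>y _. inner y v", OF _ s s]) simp
    \<comment> \<open>Pulling the constant \<open>norm v\<close> out of the integral below requires
      measurability of the error. The simple functions \<open>r j\<close> that witness strong
      measurability supply it in the limit.\<close>
    have meas: "(\<lambda>x. norm (F x - s i x)) \<in> borel_measurable ?M" for i
    proof (rule borel_measurable_lebesgue_on_AE_limit[OF D])
      have si: "simple_function ?M (s i)"
        using s[of i] by cases
      show "(\<lambda>x. norm (r j x - s i x)) \<in> borel_measurable ?M" for j
        by (intro borel_measurable_simple_function simple_function_compose2[OF r si])
      show "AE x in ?M. (\<lambda>j. norm (r j x - s i x)) \<longlonglongrightarrow> norm (F x - s i x)"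
        using rlim by (rule eventually_mono) (intro tendsto_intros)
    qed
    have bound: "(\<integral>\<^sup>+x. ennreal (norm (inner (F x) v - inner (s i x) v)) \<partial>?M)
        \<le> ennreal (norm v) * (\<integral>\<^sup>+x. ennreal (norm (F x - s i x)) \<partial>?M)" for i
    proof -
      have "(\<integral>\<^sup>+x. ennreal (norm (inner (F x) v - inner (s i x) v)) \<partial>?M)
          \<le> (\<integral>\<^sup>+x. ennreal (norm v) * ennreal (norm (F x - s i x)) \<partial>?M)"
        by (intro nn_integral_mono, subst ennreal_mult[symmetric])
          (auto simp: inner_diff_left[symmetric] mult.commute[of "norm v"]
             intro!: ennreal_leI Cauchy_Schwarz_ineq2)
      also have "\<dots> = ennreal (norm v) * (\<integral>\<^sup>+x. ennreal (norm (F x - s i x)) \<partial>?M)"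
        using meas[of i] by (intro nn_integral_cmult) simp
      finally show ?thesis .
    qed
    have "(\<lambda>i. ennreal (norm v) * (\<integral>\<^sup>+x. ennreal (norm (F x - s i x)) \<partial>?M)) \<longlonglongrightarrow> ennreal (norm v) * 0"
      using slim by (intro ennreal_tendsto_cmult) simp_all
    then have lim: "(\<lambda>i. ennreal (norm v) * (\<integral>\<^sup>+x. ennreal (norm (F x - s i x)) \<partial>?M)) \<longlonglongrightarrow> 0"
      by simp
    show "(\<lambda>i. \<integral>\<^sup>+x. ennreal (norm (inner (F x) v - inner (s i x) v)) \<partial>?M) \<longlonglongrightarrow> 0"
      by (intro tendsto_sandwich[OF always_eventually always_eventually tendsto_const lim] allI
          zero_le bound)
    have "linear (\<lambda>y. inner y v)"
      by (simp add: bounded_linear.linear bounded_linear_inner_left)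
    from simple_bochner_integral_linear[OF this s]
    show "(\<lambda>i. Bochner_Integration.simple_bochner_integral ?M (\<lambda>x. inner (s i x) v)) \<longlonglongrightarrow> inner I v"
      using sint by (auto intro!: tendsto_intros)
  qed
qed

text \<open>The difference \<open>v = I - t *\<^sub>R b\<close> is tested against itself: its
  squared norm is the integral of \<open>inner (F s - b) v\<close>, hence at most
  \<open>t * e * norm v\<close>, and one factor \<open>norm v\<close> cancels.\<close>

lemma norm_has_strong_bochner_integral_diff_le:
  fixes F :: "real \<Rightarrow> 'x::real_inner"
  assumes t: "0 \<le> t" and F: "has_strong_bochner_integral (lebesgue_on {0..t}) F I"
    and le: "\<And>s. 0 \<le> s \<Longrightarrow> s \<le> t \<Longrightarrow> norm (F s - b) \<le> e"
  shows "norm (I - t *\<^sub>R b) \<le> t * e"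
proof -
  define v where "v = I - t *\<^sub>R b"
  let ?M = "lebesgue_on {0..t}"
  have hb: "has_bochner_integral ?M (\<lambda>s. inner (F s) v) (inner I v)"
    by (rule has_strong_bochner_integral_inner[OF _ F]) simp
  have fin: "emeasure ?M (space ?M) < \<infinity>"
    using t by (simp add: emeasure_restrict_space)
  have meas: "measure ?M (space ?M) = t"
    using t by (simp add: measure_restrict_space)
  have "inner I v = (\<integral>s. inner (F s) v \<partial>?M)"
    using hb by (simp add: has_bochner_integral_iff)
  also have "\<dots> \<le> (\<integral>s. inner b v + e * norm v \<partial>?M)"
  proof (rule integral_mono)
    show "integrable ?M (\<lambda>s. inner (F s) v)"
      using hb by (simp add: has_bochner_integral_iff)
    show "integrable ?M (\<lambda>s. inner b v + e * norm v)"
      using fin by (intro finite_measure.integrable_const finite_measureI) simp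
    fix s assume "s \<in> space ?M"
    then have "norm (F s - b) * norm v \<le> e * norm v"
      using le by (intro mult_right_mono) auto
    with norm_cauchy_schwarz[of "F s - b" v]
    show "inner (F s) v \<le> inner b v + e * norm v"
      by (simp add: inner_diff_left)
  qed
  also have "\<dots> = t * (inner b v + e * norm v)"
    using meas by simp
  finally have "inner I v - t * inner b v \<le> (t * e) * norm v"
    by (simp add: algebra_simps)
  moreover have "inner v v = inner I v - t * inner b v"
    using inner_diff_left[of I "t *\<^sub>R b" v] by (simp flip: v_def)
  ultimately have "norm v * norm v \<le> (t * e) * norm v"
    by (simp add: dot_square_norm power2_eq_square)
  moreover have "0 \<le> t * e"
    using t le[of 0] order_trans[OF norm_ge_zero] by (intro mult_nonneg_nonneg) auto
  ultimately have "norm v \<le> t * e"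
    using mult_right_le_imp_le[of "norm v" "norm v" "t * e"] by (cases "v = 0") auto
  then show ?thesis
    by (simp add: v_def)
qed

section \<open>Orbits of an analytic semigroup\<close>

text \<open>The holomorphic extension is differentiable at the real point \<open>t\<close>, for
  every \<open>x\<close>. By the semigroup law the right difference quotient of the orbit at
  \<open>t\<close> is the generator quotient at \<open>S t x\<close>, so its convergence gives both
  domain membership and the value of the derivative.\<close>

lemma analytic_semigroup_has_vector_derivative:
  assumes S: "analytic_semigroup S" and A: "generator_of A DA S" and t: "t > 0"
  shows "S t x \<in> DA" and "((\<lambda>s. S s x) has_vector_derivative A (S t x)) (at t)"
proof -
  obtain \<theta> Z where \<theta>: "0 < \<theta>"
    and Z: "\<forall>t>0. \<forall>x y. Z (complex_of_real t) (x, y) = (S t x, S t y)"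
    and hol: "\<forall>p. \<forall>z\<in>sector \<theta>. \<exists>d. ((\<lambda>\<zeta>. Z \<zeta> p) has_derivative (\<lambda>h. cscale h d)) (at z)"
    using S unfolding analytic_semigroup_def by (elim conjE exE) (rule that)
  have "complex_of_real t \<in> sector \<theta>"
    using t \<theta> by (simp add: sector_def Arg_of_real)
  then obtain d where "((\<lambda>\<zeta>. Z \<zeta> (x, 0)) has_derivative (\<lambda>h. cscale h d)) (at (complex_of_real t))"
    using hol by blast
  moreover have "(complex_of_real has_derivative complex_of_real) (at t)"
    by (rule bounded_linear_imp_has_derivative[OF bounded_linear_of_real])
  ultimately have "((\<lambda>s. Z (complex_of_real s) (x, 0)) has_derivative
      (\<lambda>h. cscale (complex_of_real h) d)) (at t)"
    by (rule has_derivative_compose[rotated])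
  \<comment> \<open>For a real increment \<open>h\<close>, \<open>cscale\<close> is plain scaling of
    both components, so the first component of the complex derivative \<open>d\<close> is the
    derivative of the original orbit.\<close>
  from has_derivative_fst[OF this]
  have "((\<lambda>s. fst (Z (complex_of_real s) (x, 0))) has_vector_derivative fst d) (at t)"
    by (simp add: has_vector_derivative_def cscale_def)
  then have deriv: "((\<lambda>s. S s x) has_vector_derivative fst d) (at t)"
    by (rule has_vector_derivative_transform_within_open[of _ _ _ "{0<..}"])
      (use t in \<open>auto simp: Z\<close>)
  have semi: "S (h + t) x = S h (S t x)" if "h \<ge> 0" for h
    using S that t by (simp add: analytic_semigroup_def C0_semigroup_def)
  have "((\<lambda>h. (S (t + h) x - S t x) /\<^sub>R h) \<longlongrightarrow> fst d) (at 0)"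
  proof (rule Lim_null[THEN iffD2], rule tendsto_norm_zero_cancel)
    have lim: "((\<lambda>h. norm (S (t + h) x - S t x - h *\<^sub>R fst d) / norm h) \<longlongrightarrow> 0) (at 0)"
      using deriv by (simp add: has_vector_derivative_def has_derivative_at)
    have eq: "norm (S (t + h) x - S t x - h *\<^sub>R fst d) / norm h
        = norm ((S (t + h) x - S t x) /\<^sub>R h - fst d)" if "h \<noteq> 0" for h
    proof -
      have "(S (t + h) x - S t x) /\<^sub>R h - fst d = (S (t + h) x - S t x - h *\<^sub>R fst d) /\<^sub>R h"
        using that by (simp add: scaleR_diff_right)
      then show ?thesis
        by (simp add: divide_inverse mult.commute)
    qed
    show "((\<lambda>h. norm ((S (t + h) x - S t x) /\<^sub>R h - fst d)) \<longlongrightarrow> 0) (at 0)"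
      by (rule Lim_transform_eventually[OF lim])
        (use eq in \<open>auto simp only: eventually_at_filter intro!: always_eventually\<close>)
  qed
  then have "((\<lambda>h. (S (t + h) x - S t x) /\<^sub>R h) \<longlongrightarrow> fst d) (at_right 0)"
    by (rule tendsto_mono[OF at_le, rotated]) simp
  then have lim: "((\<lambda>h. (S h (S t x) - S t x) /\<^sub>R h) \<longlongrightarrow> fst d) (at_right 0)"
    by (rule Lim_transform_eventually)
      (auto simp: eventually_at_filter semi[symmetric] add.commute[of t])
  then show mem: "S t x \<in> DA"
    using A by (auto simp: generator_of_def)
  then have "((\<lambda>h. (S h (S t x) - S t x) /\<^sub>R h) \<longlongrightarrow> A (S t x)) (at_right 0)"
    using A by (auto simp: generator_of_def)
  with lim have "fst d = A (S t x)"
    by (intro tendsto_unique[OF _ lim]) auto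
  with deriv show "((\<lambda>s. S s x) has_vector_derivative A (S t x)) (at t)"
    by simp
qed

text \<open>Strong continuity settles \<open>t = 0\<close> and differentiability settles
  \<open>t > 0\<close>. No local bound on \<open>S\<close> enters, which matters because that bound
  is derived below from this continuity.\<close>

lemma analytic_semigroup_continuous_on:
  assumes S: "analytic_semigroup S" and A: "generator_of A DA S"
  shows "continuous_on {0..} (\<lambda>t. S t x)"
  unfolding continuous_on_eq_continuous_within
proof
  fix t :: real assume "t \<in> {0..}"
  then consider "t = 0" | "t > 0" by force
  then show "continuous (at t within {0..}) (\<lambda>t. S t x)"
  proof cases
    case 1
    have "((\<lambda>t. S t x) \<longlongrightarrow> S 0 x) (at_right 0)"
      using S by (simp add: analytic_semigroup_def C0_semigroup_def)
    with 1 show ?thesis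
      by (simp add: continuous_within at_within_Ici_at_right)
  next
    case 2
    from analytic_semigroup_has_vector_derivative(2)[OF S A this]
    show ?thesis
      by (rule continuous_at_imp_continuous_at_within[OF has_vector_derivative_continuous])
  qed
qed

section \<open>The quadratic form along the semigroup\<close>

text \<open>Symmetry of \<open>P\<close> merges the two terms of the product rule. The function
  \<open>q\<close> is kept abstract because the Lyapunov equation will provide an expression without
  \<open>A\<close>, meaningful and continuous on the whole space.\<close>

lemma quadratic_form_has_derivative:
  fixes P :: "'x::real_inner \<Rightarrow> 'x"
  assumes S: "analytic_semigroup S" and A: "generator_of A DA S"
    and P: "bounded_linear P" and sym: "\<And>x y. inner (P x) y = inner x (P y)"
    and q: "\<And>x. x \<in> DA \<Longrightarrow> 2 * inner (A x) (P x) = q x"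
    and t: "t > 0"
  shows "((\<lambda>s. inner (P (S s x)) (S s x)) has_real_derivative q (S t x)) (at t)"
proof -
  note D = analytic_semigroup_has_vector_derivative[OF S A t, of x]
  from bounded_bilinear.has_vector_derivative[OF bounded_bilinear_inner
      bounded_linear.has_vector_derivative[OF P D(2)] D(2)]
  show ?thesis
    unfolding has_real_derivative_iff_has_vector_derivative q[OF D(1), symmetric]
    using sym[of "S t x" "A (S t x)"] by (simp add: inner_commute)
qed

lemma quadratic_form_continuous_on:
  fixes P :: "'x::real_inner \<Rightarrow> 'x"
  assumes "analytic_semigroup S" "generator_of A DA S" "bounded_linear P"
  shows "continuous_on {0..} (\<lambda>t. inner (P (S t x)) (S t x))"
  by (intro continuous_intros bounded_linear.continuous_on[OF assms(3)]
      analytic_semigroup_continuous_on[OF assms(1,2)])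

text \<open>A Gronwall argument: the form along the orbit, multiplied by
  \<open>exp (- \<omega> * s)\<close>, has a nonpositive derivative. Since the orbit may fail to be
  differentiable at 0, monotonicity is obtained from the open interval and continuity at its
  ends.\<close>

lemma quadratic_form_exp_bound:
  fixes P :: "'x::real_inner \<Rightarrow> 'x"
  assumes S: "analytic_semigroup S" and A: "generator_of A DA S"
    and P: "bounded_linear P" and sym: "\<And>x y. inner (P x) y = inner x (P y)"
    and q: "\<And>x. x \<in> DA \<Longrightarrow> 2 * inner (A x) (P x) = q x"
    and le: "\<And>x. q x \<le> \<omega> * inner (P x) x"
    and t: "t \<ge> 0"
  shows "inner (P (S t x)) (S t x) \<le> exp (\<omega> * t) * inner (P x) x"
proof -
  let ?V = "\<lambda>s. inner (P (S s x)) (S s x)"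
  have "exp (- \<omega> * t) * ?V t \<le> exp (- \<omega> * 0) * ?V 0"
  proof (rule DERIV_nonpos_imp_decreasing_open[OF t])
    show "continuous_on {0..t} (\<lambda>s. exp (- \<omega> * s) * ?V s)"
      by (intro continuous_intros
          continuous_on_subset[OF quadratic_form_continuous_on[OF S A P]]) auto
    fix s :: real assume "0 < s"
    note quadratic_form_has_derivative[OF S A P sym q this, of x]
    then have "((\<lambda>s. exp (- \<omega> * s) * ?V s) has_real_derivative
        exp (- \<omega> * s) * (q (S s x) - \<omega> * ?V s)) (at s)"
      by (auto intro!: derivative_eq_intros simp: algebra_simps)
    moreover have "exp (- \<omega> * s) * (q (S s x) - \<omega> * ?V s) \<le> 0"
      using le[of "S s x"] by (intro mult_nonneg_nonpos) auto
    ultimately show "\<exists>y. ((\<lambda>s. exp (- \<omega> * s) * ?V s) has_real_derivative y) (at s) \<and> y \<le> 0"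
      by blast
  qed
  moreover have "S 0 x = x"
    using S by (simp add: analytic_semigroup_def C0_semigroup_def)
  ultimately show ?thesis
    by (simp add: exp_minus field_simps)
qed

text \<open>For \<open>x\<close> outside the domain the orbit has no derivative at 0, but
  l'Hopital's rule still applies: the derivative \<open>q (S t x)\<close> at \<open>t > 0\<close>
  tends to \<open>q x\<close> by continuity of \<open>q\<close> and strong continuity of
  \<open>S\<close>.\<close>

lemma quadratic_form_slope_tendsto:
  fixes P :: "'x::real_inner \<Rightarrow> 'x"
  assumes S: "analytic_semigroup S" and A: "generator_of A DA S"
    and P: "bounded_linear P" and sym: "\<And>x y. inner (P x) y = inner x (P y)"
    and q: "\<And>x. x \<in> DA \<Longrightarrow> 2 * inner (A x) (P x) = q x"
    and cont: "continuous_on UNIV q"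
  shows "((\<lambda>t. (inner (P (S t x)) (S t x) - inner (P x) x) / t) \<longlongrightarrow> q x) (at_right 0)"
proof (rule lhopital_right_0)
  have S0: "S 0 x = x" and Slim: "((\<lambda>t. S t x) \<longlongrightarrow> x) (at_right 0)"
    using S by (auto simp: analytic_semigroup_def C0_semigroup_def)
  have "((\<lambda>t. inner (P (S t x)) (S t x) - inner (P x) x) \<longlongrightarrow> inner (P x) x - inner (P x) x) (at_right 0)"
    by (intro tendsto_intros bounded_linear.tendsto[OF P] Slim)
  then show "((\<lambda>t. inner (P (S t x)) (S t x) - inner (P x) x) \<longlongrightarrow> 0) (at_right 0)"
    by simp
  show "((\<lambda>t. t) \<longlongrightarrow> 0) (at_right (0::real))"
    by (rule tendsto_ident_at)
  show "\<forall>\<^sub>F t in at_right 0. t \<noteq> (0::real)"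
    by (simp add: eventually_at_filter)
  show "\<forall>\<^sub>F t in at_right (0::real). (1::real) \<noteq> 0" by simp
  show "\<forall>\<^sub>F t in at_right 0. ((\<lambda>t. inner (P (S t x)) (S t x) - inner (P x) x)
      has_real_derivative q (S t x)) (at t)"
    unfolding eventually_at_filter
    by (rule always_eventually)
      (auto intro!: derivative_eq_intros quadratic_form_has_derivative[OF S A P sym q])
  show "\<forall>\<^sub>F t in at_right (0::real). ((\<lambda>t. t) has_real_derivative 1) (at t)"
    by (auto intro!: always_eventually)
  show "((\<lambda>t. q (S t x) / 1) \<longlongrightarrow> q x) (at_right 0)"
    using continuous_on_tendsto_compose[OF cont Slim] by simp
qed


text \<open>Coercivity and boundedness make the quadratic form equivalent to the squared norm, so
  its exponential bound becomes a bound on \<open>S t\<close>, uniform for \<open>t\<close> in the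
  unit interval.\<close>

lemma Lyapunov_equation_imp_locally_bounded:
  fixes P :: "'x::real_inner \<Rightarrow> 'x"
  assumes S: "analytic_semigroup S" and A: "generator_of A DA S"
    and P: "coercive_operator P" and B: "bounded_linear B"
    and q: "\<And>x. x \<in> DA \<Longrightarrow> 2 * inner (A x) (P x) = - (norm x)\<^sup>2 - 2 * inner (B x) (P x)"
  obtains K where "K > 0" "\<And>t x. 0 \<le> t \<Longrightarrow> t \<le> 1 \<Longrightarrow> norm (S t x) \<le> K * norm x"
proof -
  from P have bl: "bounded_linear P" and sym: "\<And>x y. inner (P x) y = inner x (P y)"
    by (auto simp: coercive_operator_def positive_operator_def)
  from P obtain \<epsilon> where \<epsilon>: "\<epsilon> > 0" "\<And>x. inner (P x) x \<ge> \<epsilon> * (norm x)\<^sup>2"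
    by (auto simp: coercive_operator_def)
  obtain kP where kP: "kP > 0" "\<And>x. norm (P x) \<le> norm x * kP"
    using bounded_linear.pos_bounded[OF bl] by blast
  obtain kB where kB: "kB > 0" "\<And>x. norm (B x) \<le> norm x * kB"
    using bounded_linear.pos_bounded[OF B] by blast
  \<comment> \<open>Dropping the term \<open>- (norm x)\<^sup>2\<close>, the right-hand side of the
    Lyapunov equation is at most \<open>2 * kB * kP * (norm x)\<^sup>2\<close>; coercivity turns
    this into \<open>\<omega>\<close> times the form.\<close>
  define \<omega> where "\<omega> = 2 * kB * kP / \<epsilon>"
  have \<omega>: "\<omega> \<ge> 0"
    using \<epsilon> kP kB by (simp add: \<omega>_def)
  have le: "- (norm x)\<^sup>2 - 2 * inner (B x) (P x) \<le> \<omega> * inner (P x) x" for x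
  proof -
    have "\<bar>inner (B x) (P x)\<bar> \<le> norm (B x) * norm (P x)"
      by (rule Cauchy_Schwarz_ineq2)
    also have "\<dots> \<le> (norm x * kB) * (norm x * kP)"
      using kB kP by (intro mult_mono) auto
    also have "\<dots> = kB * kP * (norm x)\<^sup>2"
      by (simp add: power2_eq_square)
    finally have "- (norm x)\<^sup>2 - 2 * inner (B x) (P x) \<le> 2 * (kB * kP * (norm x)\<^sup>2)"
      using zero_le_power2[of "norm x"] by linarith
    also have "\<dots> = \<omega> * (\<epsilon> * (norm x)\<^sup>2)"
      using \<epsilon> by (simp add: \<omega>_def)
    also have "\<dots> \<le> \<omega> * inner (P x) x"
      using \<epsilon> \<omega> by (intro mult_left_mono) auto
    finally show ?thesis .
  qed
  define K where "K = sqrt (exp \<omega> * kP / \<epsilon>)"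
  have "norm (S t x) \<le> K * norm x" if t: "0 \<le> t" "t \<le> 1" for t x
  proof (rule power2_le_imp_le)
    have "\<epsilon> * (norm (S t x))\<^sup>2 \<le> inner (P (S t x)) (S t x)"
      by (rule \<epsilon>)
    also have "\<dots> \<le> exp (\<omega> * t) * inner (P x) x"
      by (rule quadratic_form_exp_bound[OF S A bl sym q le t(1)])
    also have "\<dots> \<le> exp \<omega> * (norm x * kP * norm x)"
    proof (intro mult_mono)
      show "exp (\<omega> * t) \<le> exp \<omega>"
        using \<omega> t by (simp add: mult_left_le)
      have "inner (P x) x \<le> norm (P x) * norm x"
        by (rule norm_cauchy_schwarz)
      also have "\<dots> \<le> norm x * kP * norm x"
        using kP by (intro mult_right_mono) auto
      finally show "inner (P x) x \<le> norm x * kP * norm x" .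
      show "0 \<le> inner (P x) x"
        using \<epsilon>(1) order_trans[OF _ \<epsilon>(2)] by (metis mult_nonneg_nonneg less_imp_le zero_le_power2)
    qed simp
    finally have "(norm (S t x))\<^sup>2 \<le> exp \<omega> * kP / \<epsilon> * (norm x)\<^sup>2"
      using \<epsilon>(1) by (simp add: field_simps power2_eq_square)
    then show "(norm (S t x))\<^sup>2 \<le> (K * norm x)\<^sup>2"
      using \<epsilon>(1) kP(1) by (simp add: K_def power_mult_distrib)
    show "0 \<le> K * norm x"
      using \<epsilon>(1) kP(1) by (simp add: K_def)
  qed
  moreover have "K > 0"
    using \<epsilon>(1) kP(1) by (simp add: K_def)
  ultimately show ?thesis
    using that by blast
qed

section \<open>Mild solutions for small times\<close>

text \<open>At time 0 the integral runs over a single point. The preceding norm estimate with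
  \<open>t = 0\<close>, with the integrand's value there as \<open>b\<close> and with
  \<open>e = 0\<close>, forces it to vanish.\<close>

lemma mild_solution_initial_value:
  fixes y :: "real \<Rightarrow> 'x::real_inner"
  assumes "C0_semigroup S" "mild_solution S Q f x u \<tau> y" "0 < \<tau>"
  shows "y 0 = x"
proof -
  have "has_strong_bochner_integral (lebesgue_on {0..0}) (\<lambda>s. S (0 - s) (f (y s) (u s))) (y 0 - S 0 x)"
    using assms(2,3) by (auto simp: mild_solution_def zero_ereal_def)
  from norm_has_strong_bochner_integral_diff_le[OF order_refl this, of "S 0 (f (y 0) (u 0))" 0]
  have "norm (y 0 - S 0 x) \<le> 0"
    by auto
  then show ?thesis
    using assms(1) by (simp add: C0_semigroup_def)
qed

lemma mild_solution_tendsto: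
  fixes y :: "real \<Rightarrow> 'x::real_inner"
  assumes "C0_semigroup S" "mild_solution S Q f x u \<tau> y" "0 < \<tau>"
  shows "(y \<longlongrightarrow> x) (at_right 0)"
proof -
  obtain \<delta> where \<delta>: "0 < \<delta>" "ereal \<delta> < \<tau>"
    using ereal_dense2[OF assms(3)] by auto
  have sub: "{0..\<delta>} \<subseteq> {t. 0 \<le> t \<and> ereal t < \<tau>}"
    using \<delta> by (auto intro: le_less_trans[of _ "ereal \<delta>"])
  have "continuous_on {0..\<delta>} y"
    by (rule continuous_on_subset[OF _ sub]) (use assms(2) in \<open>simp add: mild_solution_def\<close>)
  then have "(y \<longlongrightarrow> y 0) (at_right 0)"
    using \<delta>(1) by (simp add: continuous_on_Icc_at_rightD)
  then show ?thesis
    by (simp add: mild_solution_initial_value[OF assms])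
qed

text \<open>The integrand is split as \<open>S (t - s) (f - b) + (S (t - s) b - b)\<close> plus
  \<open>b\<close>. The first part is at most \<open>K * H\<close>, and the second is at most
  \<open>\<eta>\<close> for small \<open>t\<close> by strong continuity at the one vector
  \<open>b\<close>.\<close>

lemma mild_solution_increment:
  fixes y :: "real \<Rightarrow> 'x::real_inner"
  assumes S: "C0_semigroup S" and y: "mild_solution S Q f x u \<tau> y" and "0 < \<tau>"
    and K: "K > 0" "\<And>t x. 0 \<le> t \<Longrightarrow> t \<le> 1 \<Longrightarrow> norm (S t x) \<le> K * norm x"
    and \<delta>: "\<delta> > 0" "\<And>s. 0 \<le> s \<Longrightarrow> s < \<delta> \<Longrightarrow> ereal s < \<tau> \<Longrightarrow> norm (f (y s) (u s) - b) \<le> H"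
    and \<eta>: "\<eta> > 0"
  shows "\<forall>\<^sub>F t in at_right 0. norm (y t - S t x - t *\<^sub>R b) \<le> t * (K * H + \<eta>)"
proof -
  have "((\<lambda>t. S t b) \<longlongrightarrow> b) (at_right 0)"
    using S by (simp add: C0_semigroup_def)
  from tendstoD[OF this \<eta>] obtain \<delta>1 where \<delta>1: "\<delta>1 > 0"
    "\<And>r. 0 < r \<Longrightarrow> r < \<delta>1 \<Longrightarrow> norm (S r b - b) < \<eta>"
    by (auto simp: eventually_at_right_field dist_norm)
  have \<delta>1': "norm (S r b - b) \<le> \<eta>" if "0 \<le> r" "r < \<delta>1" for r
    using \<delta>1(2)[of r] that \<eta> S by (cases "r = 0") (auto simp: C0_semigroup_def less_imp_le)
  obtain \<delta>2 where \<delta>2: "0 < \<delta>2" "ereal \<delta>2 < \<tau>"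
    using ereal_dense2[OF \<open>0 < \<tau>\<close>] by auto
  \<comment> \<open>The four entries secure, in order, the bound \<open>H\<close>, the closeness of
    \<open>S r b\<close> to \<open>b\<close>, existence of the solution, and the range in which
    \<open>K\<close> is valid.\<close>
  define \<delta>0 where "\<delta>0 = Min {\<delta>, \<delta>1, \<delta>2, 1}"
  have \<delta>0: "\<delta>0 > 0"
    using \<delta>(1) \<delta>1(1) \<delta>2(1) by (simp add: \<delta>0_def)
  have "norm (y t - S t x - t *\<^sub>R b) \<le> t * (K * H + \<eta>)" if t: "0 < t" "t < \<delta>0" for t
  proof (rule norm_has_strong_bochner_integral_diff_le)
    have t\<tau>: "ereal s < \<tau>" if "s \<le> t" for s
      using that t \<delta>2(2) by (intro le_less_trans[OF _ \<delta>2(2)]) (simp add: \<delta>0_def)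
    show "has_strong_bochner_integral (lebesgue_on {0..t}) (\<lambda>s. S (t - s) (f (y s) (u s))) (y t - S t x)"
      using y t t\<tau>[of t] by (simp add: mild_solution_def)
    fix s assume s: "0 \<le> s" "s \<le> t"
    interpret S: bounded_linear "S (t - s)"
      using S s by (simp add: C0_semigroup_def)
    have "S (t - s) (f (y s) (u s)) - b
        = S (t - s) (f (y s) (u s) - b) + (S (t - s) b - b)"
      by (simp add: S.diff)
    also have "norm \<dots> \<le> K * norm (f (y s) (u s) - b) + \<eta>"
      using s t by (intro norm_triangle_mono K(2) \<delta>1') (auto simp: \<delta>0_def)
    also have "\<dots> \<le> K * H + \<eta>"
      using s t t\<tau> K(1) \<delta>(2)[of s] by (intro add_right_mono mult_left_mono) (auto simp: \<delta>0_def)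
    finally show "norm (S (t - s) (f (y s) (u s)) - b) \<le> K * H + \<eta>" .
  qed (use t in simp)
  then show ?thesis
    using \<delta>0 by (auto simp: eventually_at_right_field)
qed

section \<open>Lie derivative of the quadratic form\<close>

text \<open>With \<open>\<phi> t x u = S t x + t *\<^sub>R (b + e)\<close> and
  \<open>norm e \<le> E\<close>, expanding the form leaves the slope along \<open>S\<close>, a cross
  term linear in \<open>b + e\<close>, and a term of order \<open>t\<close>. As \<open>e\<close> is
  only bounded and need not converge, the result is an inequality.\<close>

lemma Lie_derivative_quadratic_form_le:
  fixes P :: "'x::real_inner \<Rightarrow> 'x"
  assumes S: "C0_semigroup S" and P: "bounded_linear P"
    and sym: "\<And>x y. inner (P x) y = inner x (P y)"
    and kP: "\<And>x. norm (P x) \<le> norm x * kP" "kP \<ge> 0"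
    and slope: "((\<lambda>t. (inner (P (S t x)) (S t x) - inner (P x) x) / t) \<longlongrightarrow> c) (at_right 0)"
    and inc: "\<forall>\<^sub>F t in at_right 0. norm (\<phi> t x u - S t x - t *\<^sub>R b) \<le> t * E"
  shows "Lie_derivative \<phi> (\<lambda>x. inner (P x) x) u x \<le> ereal (c + 2 * inner (P x) b + 2 * norm x * kP * E)"
proof -
  interpret P: bounded_linear P by (fact P)
  let ?V = "\<lambda>x. inner (P x) x"
  \<comment> \<open>\<open>F\<close> majorizes the difference quotient and, unlike it, has a limit
    at 0; its last summand vanishes there.\<close>
  define F where "F t = (?V (S t x) - ?V x) / t + 2 * inner (P (S t x)) b
      + 2 * norm (S t x) * kP * E + t * ((norm b + E) * kP * (norm b + E))" for t
  have Slim: "((\<lambda>t. S t x) \<longlongrightarrow> x) (at_right 0)"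
    using S by (simp add: C0_semigroup_def)
  have "(F \<longlongrightarrow> c + 2 * inner (P x) b + 2 * norm x * kP * E + 0 * ((norm b + E) * kP * (norm b + E)))
      (at_right 0)"
    unfolding F_def by (intro tendsto_intros slope P.tendsto Slim)
  then have Flim: "(F \<longlongrightarrow> c + 2 * inner (P x) b + 2 * norm x * kP * E) (at_right 0)"
    by simp
  have "\<forall>\<^sub>F t in at_right 0. (?V (\<phi> t x u) - ?V x) / t \<le> F t"
    using inc eventually_at_right_less[of 0]
  proof eventually_elim
    case (elim t)
    define e where "e = (\<phi> t x u - S t x - t *\<^sub>R b) /\<^sub>R t"
    have "norm e = norm (\<phi> t x u - S t x - t *\<^sub>R b) / t"
      using elim by (simp add: e_def divide_inverse mult.commute)
    with elim have e: "norm e \<le> E"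
      by (simp add: pos_divide_le_eq mult.commute)
    have phi: "\<phi> t x u = S t x + t *\<^sub>R (b + e)"
      using elim by (simp add: e_def scaleR_add_right)
    have "?V (\<phi> t x u) = ?V (S t x) + t * (2 * inner (P (S t x)) (b + e)) + t * (t * ?V (b + e))"
      unfolding phi using sym[of b "S t x"] sym[of e "S t x"]
      by (simp add: P.add P.scaleR inner_simps inner_commute algebra_simps)
    then have "(?V (\<phi> t x u) - ?V x) / t = (?V (S t x) - ?V x) / t
        + 2 * inner (P (S t x)) b + 2 * inner (P (S t x)) e + t * ?V (b + e)"
      using elim by (simp add: field_simps inner_add_right)
    moreover have "inner (P (S t x)) e \<le> norm (S t x) * kP * E"
    proof -
      have "inner (P (S t x)) e \<le> norm (P (S t x)) * norm e"
        by (rule norm_cauchy_schwarz)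
      also have "\<dots> \<le> norm (S t x) * kP * E"
        using kP e by (intro mult_mono) auto
      finally show ?thesis .
    qed
    moreover have "?V (b + e) \<le> (norm b + E) * kP * (norm b + E)"
    proof -
      have be: "norm (b + e) \<le> norm b + E"
        using e by (intro norm_triangle_mono) auto
      have "?V (b + e) \<le> norm (P (b + e)) * norm (b + e)"
        by (rule norm_cauchy_schwarz)
      also have "\<dots> \<le> (norm (b + e) * kP) * norm (b + e)"
        using kP by (intro mult_right_mono) auto
      also have "\<dots> \<le> (norm b + E) * kP * (norm b + E)"
        using be kP order_trans[OF norm_ge_zero be] by (intro mult_mono) auto
      finally show ?thesis .
    qed
    then have "t * ?V (b + e) \<le> t * ((norm b + E) * kP * (norm b + E))"
      using elim by (intro mult_left_mono) auto
    ultimately show ?case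
      by (simp add: F_def)
  qed
  then have "Lie_derivative \<phi> ?V u x \<le> Limsup (at_right 0) (\<lambda>t. ereal (F t))"
    unfolding Lie_derivative_def by (intro Limsup_mono) simp
  also have "\<dots> = ereal (c + 2 * inner (P x) b + 2 * norm x * kP * E)"
    using Flim by (intro lim_imp_Limsup) auto
  finally show ?thesis .
qed

section \<open>Quadratic comparison functions and the Lyapunov estimate\<close>

lemma class_K_inf_square:
  fixes a :: real
  assumes "a > 0"
  shows "class_K_inf (\<lambda>r. a * r\<^sup>2)"
  unfolding class_K_inf_def class_K_def
proof (intro conjI)
  show "strict_mono_on {0..} (\<lambda>r. a * r\<^sup>2)"
    using assms by (intro strict_mono_onI mult_strict_left_mono power_strict_mono) auto
  show "\<not> bdd_above ((\<lambda>r. a * r\<^sup>2) ` {0..})"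
  proof
    assume "bdd_above ((\<lambda>r. a * r\<^sup>2) ` {0..})"
    then obtain b where b: "\<And>r. 0 \<le> r \<Longrightarrow> a * r\<^sup>2 \<le> b"
      by (auto simp: bdd_above_def)
    have "a * (sqrt ((\<bar>b\<bar> + 1) / a))\<^sup>2 = \<bar>b\<bar> + 1"
      using assms by simp
    with b[of "sqrt ((\<bar>b\<bar> + 1) / a)"] assms show False
      by simp
  qed
qed (auto intro!: continuous_intros)

theorem theorem3:
  fixes A B R P :: "'x::{real_inner, complete_space} \<Rightarrow> 'x"
    and DA :: "'x set"
    and C :: "'u::real_normed_vector \<Rightarrow> 'x"
    and f g :: "'x \<Rightarrow> 'u \<Rightarrow> 'x"
    and Q :: "('x \<times> 'u) set"
    and S T :: "real \<Rightarrow> 'x \<Rightarrow> 'x"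
    and Uc :: "(real \<Rightarrow> 'u) set"
    and tm tm_lin :: "'x \<Rightarrow> (real \<Rightarrow> 'u) \<Rightarrow> ereal"
    and \<phi> \<phi>_lin :: "real \<Rightarrow> 'x \<Rightarrow> (real \<Rightarrow> 'u) \<Rightarrow> 'x"
  assumes "analytic_semigroup S" and "generator_of A DA S"
    and "open Q" and "(0, 0) \<in> Q" and "f 0 0 = 0"
    and "bounded_linear B" and "bounded_linear C"
    and "\<And>x u. (x, u) \<in> Q \<Longrightarrow> f x u = B x + C u + g x u"
    and "\<And>w. w > 0 \<Longrightarrow> \<exists>\<rho>>0. \<forall>x u. norm x \<le> \<rho> \<and> norm u \<le> \<rho> \<longrightarrow>
           (x, u) \<in> Q \<and> norm (g x u) \<le> w * (norm x + norm u)"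
    and "\<And>x. x \<in> DA \<Longrightarrow> R x = A x + B x"
    and "analytic_semigroup T" and "generator_of R DA T"
    and "input_space Uc"
    and "control_system S Q f Uc tm \<phi>"
    and "control_system T UNIV (\<lambda>x u. C u) Uc tm_lin \<phi>_lin"
    and "input_to_state_stable Uc tm_lin \<phi>_lin"
    and "coercive_operator P"
    and "\<And>x. x \<in> DA \<Longrightarrow> inner (R x) (P x) + inner (P x) (R x) = - (norm x)\<^sup>2"
  shows "local_ISS_Lyapunov_function Uc tm \<phi> UNIV (\<lambda>x. inner (P x) x)"
proof -
  note S = \<open>analytic_semigroup S\<close> and A = \<open>generator_of A DA S\<close>
  have C0: "C0_semigroup S"
    using S by (simp add: analytic_semigroup_def)
  from \<open>coercive_operator P\<close> have bl: "bounded_linear P"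
    and sym: "\<And>x y. inner (P x) y = inner x (P y)"
    by (auto simp: coercive_operator_def positive_operator_def)
  from \<open>coercive_operator P\<close> obtain \<epsilon> where \<epsilon>: "\<epsilon> > 0" "\<And>x. inner (P x) x \<ge> \<epsilon> * (norm x)\<^sup>2"
    by (auto simp: coercive_operator_def)
  obtain kP where kP: "kP > 0" "\<And>x. norm (P x) \<le> norm x * kP"
    using bounded_linear.pos_bounded[OF bl] by blast
  obtain kB where kB: "kB > 0" "\<And>x. norm (B x) \<le> norm x * kB"
    using bounded_linear.pos_bounded[OF \<open>bounded_linear B\<close>] by blast
  obtain kC where kC: "kC > 0" "\<And>u. norm (C u) \<le> norm u * kC"
    using bounded_linear.pos_bounded[OF \<open>bounded_linear C\<close>] by blast
  define q where "q x = - (norm x)\<^sup>2 - 2 * inner (B x) (P x)" for x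
  have q: "2 * inner (A x) (P x) = q x" if "x \<in> DA" for x
    using assms(10)[OF that] assms(18)[OF that]
    by (simp add: q_def inner_add_left inner_add_right inner_commute)
  have q_cont: "continuous_on UNIV q"
    unfolding q_def
    by (intro continuous_intros bounded_linear.continuous_on[OF bl]
        bounded_linear.continuous_on[OF \<open>bounded_linear B\<close>])
  obtain K where K: "K > 0" "\<And>t x. 0 \<le> t \<Longrightarrow> t \<le> 1 \<Longrightarrow> norm (S t x) \<le> K * norm x"
    using Lyapunov_equation_imp_locally_bounded[OF S A \<open>coercive_operator P\<close> \<open>bounded_linear B\<close> q[unfolded q_def]]
    by blast
  \<comment> \<open>These constants limit the drift of the state to
    \<open>\<kappa> * norm x\<close>, the input to \<open>c * norm x\<close>, and the nonlinearity
    through \<open>w\<close>. Each source contributes at most \<open>norm x / 16\<close> to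
    \<open>kP * (K * H + \<eta>)\<close> below, well within the required
    \<open>3 / 8 * norm x\<close>. The caps at 1 bound drift and input by \<open>norm x\<close>,
    whence the factor 3 in \<open>48 = 16 * 3\<close>.\<close>
  define \<kappa> where "\<kappa> = min 1 (1 / (16 * kP * (K * kB + 1)))"
  define c where "c = min 1 (1 / (16 * kP * K * kC))"
  define w where "w = 1 / (48 * kP * K)"
  have \<kappa>: "0 < \<kappa>" "\<kappa> \<le> 1" "kP * ((K * kB + 1) * \<kappa>) \<le> 1 / 16"
    using kP(1) K(1) kB(1) by (auto simp: \<kappa>_def min_def field_simps add_pos_pos)
  have c: "0 < c" "c \<le> 1" "kP * (K * (kC * c)) \<le> 1 / 16"
    using kP(1) K(1) kC(1) by (auto simp: c_def min_def field_simps)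
  have w: "0 < w" "kP * (K * (w * 3)) = 1 / 16"
    using kP(1) K(1) by (auto simp: w_def field_simps)
  obtain \<rho> where \<rho>: "\<rho> > 0" "\<And>x u. norm x \<le> \<rho> \<Longrightarrow> norm u \<le> \<rho> \<Longrightarrow>
      (x, u) \<in> Q \<and> norm (g x u) \<le> w * (norm x + norm u)"
    using assms(9)[OF w(1)] by blast
  \<comment> \<open>Halving \<open>\<rho>\<close> leaves room for the state to move by
    \<open>\<rho> / 2\<close> without leaving the region where \<open>g\<close> is
    controlled.\<close>
  have main: "0 < tm x u \<and> Lie_derivative \<phi> (\<lambda>x. inner (P x) x) u x \<le> ereal (- ((norm x)\<^sup>2 / 4))"
    if u: "u \<in> Uc" and x\<rho>: "norm x \<le> \<rho> / 2" and u\<rho>: "input_norm u \<le> \<rho> / 2"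
      and ux: "input_norm u / c \<le> norm x" for x u
  proof -
    have ule: "norm (u s) \<le> input_norm u" if "0 \<le> s" for s
    proof -
      have "bdd_above ((\<lambda>s. norm (u s)) ` {0..})"
        using u \<open>input_space Uc\<close> by (auto simp: input_space_def bounded_iff bdd_above_def)
      then show ?thesis
        using that unfolding input_norm_def by (intro cSUP_upper) auto
    qed
    have uc: "input_norm u \<le> c * norm x"
      using ux c by (simp add: field_simps)
    \<comment> \<open>This is the condition for local existence in \<open>control_system\<close>;
      the interval length 1 is arbitrary, since the bound on the input holds for all times.\<close>
    have "well_inside Q ({x} \<times> u ` {0..<1})"
      unfolding well_inside_def
    proof (intro exI[of _ "\<rho> / 2"] conjI ballI subsetI)
      fix z p assume "z \<in> {x} \<times> u ` {0..<1}" and p: "p \<in> ball z (\<rho> / 2)"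
      then obtain s where s: "0 \<le> s" "z = (x, u s)" by auto
      have "norm (fst p) \<le> \<rho>"
        using p x\<rho> dist_fst_le[of z p] norm_triangle_sub[of "fst p" x]
        by (simp add: s dist_norm norm_minus_commute)
      moreover have "norm (snd p) \<le> \<rho>"
        using p u\<rho> ule[OF s(1)] dist_snd_le[of z p] norm_triangle_sub[of "snd p" "u s"]
        by (simp add: s dist_norm norm_minus_commute)
      ultimately show "p \<in> Q"
        using \<rho>(2)[of "fst p" "snd p"] by simp
    qed (use \<rho> in simp)
    then have tm: "0 < tm x u"
      using \<open>control_system S Q f Uc tm \<phi>\<close> u unfolding control_system_def
      by (meson zero_less_one)
    have mild: "mild_solution S Q f x u (tm x u) (\<lambda>t. \<phi> t x u)"
      using \<open>control_system S Q f Uc tm \<phi>\<close> u by (simp add: control_system_def)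
    text \<open>The tolerance \<open>\<eta>\<close> has to scale with \<open>norm x\<close>; for \<open>x = 0\<close> any \<open>\<eta> > 0\<close> will do, since
      then the error enters \<open>Lie_derivative_quadratic_form_le\<close> with the factor \<open>0\<close>.\<close>
    define \<eta> where "\<eta> = (if x = 0 then min \<rho> 1 else \<kappa> * norm x) / 2"
    have \<eta>: "\<eta> > 0" and \<eta>\<rho>: "\<eta> \<le> \<rho> / 2"
      using \<kappa> \<rho>(1) x\<rho> mult_right_mono[OF \<kappa>(2), of "norm x"] by (auto simp: \<eta>_def)
    \<comment> \<open>The summands bound \<open>B (\<phi> s x u - x)\<close>, \<open>C (u s)\<close>
      and \<open>g\<close>. The input term is treated as an error around \<open>b = B x\<close>,
      because \<open>u\<close> need not have a limit at time 0.\<close>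
    define H where "H = kB * \<eta> + kC * input_norm u + w * (norm x + \<eta> + input_norm u)"
    from tendstoD[OF mild_solution_tendsto[OF C0 mild tm] \<eta>]
    obtain \<delta> where \<delta>: "\<delta> > 0" "\<And>s. 0 < s \<Longrightarrow> s < \<delta> \<Longrightarrow> norm (\<phi> s x u - x) < \<eta>"
      by (auto simp: eventually_at_right_field dist_norm)
    have "norm (f (\<phi> s x u) (u s) - B x) \<le> H" if s: "0 \<le> s" "s < \<delta>" "ereal s < tm x u" for s
    proof -
      have d: "norm (\<phi> s x u - x) \<le> \<eta>"
        using \<delta>(2)[of s] s \<eta> mild_solution_initial_value[OF C0 mild tm]
        by (cases "s = 0") (auto simp: less_imp_le)
      then have n: "norm (\<phi> s x u) \<le> norm x + \<eta>"
        using norm_triangle_sub[of "\<phi> s x u" x] by simp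
      have "norm (\<phi> s x u) \<le> \<rho>" "norm (u s) \<le> \<rho>"
        using n x\<rho> \<eta>\<rho> ule[OF s(1)] u\<rho> \<rho>(1) by auto
      from \<rho>(2)[OF this] have Q: "(\<phi> s x u, u s) \<in> Q"
        and "norm (g (\<phi> s x u) (u s)) \<le> w * (norm (\<phi> s x u) + norm (u s))" by auto
      note this(2)
      also have "\<dots> \<le> w * (norm x + \<eta> + input_norm u)"
        using n ule[OF s(1)] w(1) by (intro mult_left_mono add_mono) auto
      finally have g: "norm (g (\<phi> s x u) (u s)) \<le> w * (norm x + \<eta> + input_norm u)" .
      have C: "norm (C (u s)) \<le> kC * input_norm u"
        using order_trans[OF kC(2) mult_right_mono[OF ule[OF s(1)]]] kC(1)
        by (simp add: mult.commute)
      have B: "norm (B (\<phi> s x u - x)) \<le> kB * \<eta>"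
        using order_trans[OF kB(2) mult_right_mono[OF d]] kB(1) by (simp add: mult.commute)
      have "f (\<phi> s x u) (u s) - B x = B (\<phi> s x u - x) + C (u s) + g (\<phi> s x u) (u s)"
        using assms(8)[OF Q] linear_diff[OF bounded_linear.linear[OF \<open>bounded_linear B\<close>]] by simp
      then show ?thesis
        unfolding H_def using B C g by (auto intro!: norm_triangle_mono)
    qed
    from mild_solution_increment[OF C0 mild tm K \<delta>(1) this \<eta>]
    have inc: "\<forall>\<^sub>F t in at_right 0. norm (\<phi> t x u - S t x - t *\<^sub>R B x) \<le> t * (K * H + \<eta>)"
      by simp
    have "Lie_derivative \<phi> (\<lambda>x. inner (P x) x) u x
        \<le> ereal (q x + 2 * inner (P x) (B x) + 2 * norm x * kP * (K * H + \<eta>))"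
      using kP(1) inc by (intro Lie_derivative_quadratic_form_le[OF C0 bl sym kP(2)]
          quadratic_form_slope_tendsto[OF S A bl sym q q_cont]) simp_all
    \<comment> \<open>The \<open>B\<close> term of \<open>q\<close> cancels against the drift
      \<open>b = B x\<close>, leaving \<open>- (norm x)\<^sup>2\<close>; the error takes up at most
      three quarters of it.\<close>
    also have "q x + 2 * inner (P x) (B x) + 2 * norm x * kP * (K * H + \<eta>) \<le> - ((norm x)\<^sup>2 / 4)"
    proof (cases "x = 0")
      case True
      then show ?thesis
        using linear_0[OF bounded_linear.linear[OF \<open>bounded_linear B\<close>]] by (simp add: q_def)
    next
      case False
      then have \<eta>x: "\<eta> \<le> \<kappa> * norm x"
        using \<kappa> by (simp add: \<eta>_def)
      have "\<eta> \<le> norm x"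
        using \<eta>x mult_right_mono[OF \<kappa>(2), of "norm x"] by simp
      moreover have "input_norm u \<le> norm x"
        using uc mult_right_mono[OF c(2), of "norm x"] by simp
      ultimately have "w * (norm x + \<eta> + input_norm u) \<le> w * (3 * norm x)"
        using w(1) by (intro mult_left_mono) auto
      moreover have "kB * \<eta> \<le> kB * (\<kappa> * norm x)" "kC * input_norm u \<le> kC * (c * norm x)"
        using \<eta>x uc kB(1) kC(1) by simp_all
      ultimately have "H \<le> kB * (\<kappa> * norm x) + kC * (c * norm x) + w * (3 * norm x)"
        by (simp add: H_def)
      then have "kP * (K * H + \<eta>)
          \<le> kP * (K * (kB * (\<kappa> * norm x) + kC * (c * norm x) + w * (3 * norm x)) + \<kappa> * norm x)"
        using kP(1) K(1) \<eta>x by (intro mult_left_mono add_mono) auto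
      also have "\<dots> = (kP * ((K * kB + 1) * \<kappa>) + kP * (K * (kC * c)) + kP * (K * (w * 3))) * norm x"
        by (simp add: algebra_simps)
      also have "\<dots> \<le> (3 / 8) * norm x"
        using \<kappa>(3) c(3) w(2) by (intro mult_right_mono) auto
      finally have "2 * norm x * (kP * (K * H + \<eta>)) \<le> 2 * norm x * ((3 / 8) * norm x)"
        by (intro mult_left_mono) auto
      also have "\<dots> = 3 / 4 * (norm x)\<^sup>2"
        by (simp add: power2_eq_square)
      finally have "2 * norm x * kP * (K * H + \<eta>) \<le> 3 / 4 * (norm x)\<^sup>2"
        by (simp only: mult.assoc)
      then show ?thesis
        unfolding q_def inner_commute[of "B x"] by linarith
    qed
    finally show ?thesis
      using tm by simp
  qed
  show ?thesis
    unfolding local_ISS_Lyapunov_function_def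
  proof (intro conjI)
    show "continuous_on UNIV (\<lambda>x. inner (P x) x)"
      by (intro continuous_intros bounded_linear.continuous_on[OF bl])
    show "\<forall>x\<in>UNIV. 0 \<le> inner (P x) x"
      using \<epsilon> by (auto intro: order_trans[OF _ \<epsilon>(2)])
    have upper: "inner (P x) x \<le> kP * (norm x)\<^sup>2" for x
    proof -
      have "inner (P x) x \<le> norm (P x) * norm x"
        by (rule norm_cauchy_schwarz)
      also have "\<dots> \<le> (norm x * kP) * norm x"
        by (intro mult_right_mono kP) auto
      finally show ?thesis
        by (simp add: power2_eq_square mult_ac)
    qed
    show "\<exists>\<rho>x>0. \<exists>\<rho>u>0. \<exists>\<psi>1 \<psi>2 \<eta> \<alpha>.
        cball 0 \<rho>x \<subseteq> interior UNIV \<and>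
        class_K_inf \<psi>1 \<and> class_K_inf \<psi>2 \<and> class_K \<eta> \<and> positive_definite_fun \<alpha> \<and>
        (\<forall>x\<in>UNIV. \<psi>1 (norm x) \<le> inner (P x) x \<and> inner (P x) x \<le> \<psi>2 (norm x)) \<and>
        (\<forall>x. \<forall>u\<in>Uc. norm x \<le> \<rho>x \<and> input_norm u \<le> \<rho>u \<and> norm x \<ge> \<eta> (input_norm u) \<longrightarrow>
           0 < tm x u \<and> Lie_derivative \<phi> (\<lambda>x. inner (P x) x) u x \<le> ereal (- \<alpha> (norm x)))"
    \<comment> \<open>The gain \<open>r / c\<close> encodes the smallness condition
      \<open>input_norm u \<le> c * norm x\<close>; the two quadratic bounds come from coercivity
      and boundedness of \<open>P\<close>.\<close>
    proof (rule exI[of _ "\<rho> / 2"], rule conjI[rotated], rule exI[of _ "\<rho> / 2"],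
        rule conjI[rotated], rule exI[of _ "\<lambda>r. \<epsilon> * r\<^sup>2"], rule exI[of _ "\<lambda>r. kP * r\<^sup>2"],
        rule exI[of _ "\<lambda>r. r / c"], rule exI[of _ "\<lambda>r. r\<^sup>2 / 4"], intro conjI)
      show "class_K (\<lambda>r. r / c)"
        using c(1) by (auto simp: class_K_def divide_strict_right_mono
            intro!: continuous_intros strict_mono_onI)
      show "positive_definite_fun (\<lambda>r. r\<^sup>2 / 4)"
        by (auto simp: positive_definite_fun_def intro!: continuous_intros)
    qed (use \<rho>(1) class_K_inf_square[OF \<epsilon>(1)] class_K_inf_square[OF kP(1)] \<epsilon>(2) upper main in auto)
  qed simp
qed

end
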